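(* The average forest measure verifies successor equivalence: for every organisational situation $(N,v,\Gamma)$ with $\Gamma=(N,A)$ and every arc $(i_0,j_0)\in A$, writing $\Gamma^{-i_0j_0}=(N,A\setminus\{(i_0,j_0)\})$, $$AF_k(N,v,\Gamma)=AF_k(N,v,\Gamma^{-i_0j_0})\qquad\text{for all } k\in\bar S^\Gamma(j_0).$$
   Context: Let $N=\{1,\dots,n\}$, $n\ge 2$. A TU game on $N$ is a function $v:2^N\to\mathbb{R}$ with $v(\emptyset)=0$; it is superadditive if $v(S\cup Q)\ge v(S)+v(Q)$ for all disjoint $S,Q\subseteq N$. A digraph $\Gamma=(N,A)$ on $N$ has arc set $A\subseteq\{(i,j)\mid i,j\in N,\ i\ne j\}$. A circuit is a directed cycle (of length at least 2). Connectedness and connected components of a digraph are understood in the weak sense (arc directions ignored). If there is a directed path from $i$ to $j$ (with at least one arc), $j$ is a successor of $i$ and $i$ is a predecessor of $j$; if $(i,j)\in A$, they are immediate successor/predecessor. $S^\Gamma(i)$ and $\widehat S^\Gamma(i)$ denote the sets of successors and immediate successors of $i$, and $\bar S^\Gamma(i)=S^\Gamma(i)\cup\{i\}$. An arborescence is a weakly connected circuit-free digraph having a unique root (a node from which every other node is reachable by a directed path) such that the directed path from the root to any other node is unique (a single node is an arborescence). A forest is a digraph whose connected components are arborescences. A spanning forest of $\Gamma=(N,A)$ is a forest $(N,A')$ with $A'\subseteq A$; it is maximal if adding to it any other arc of $A$ does not give a forest. $\mathcal{F}^\Gamma$ denotes the set of maximal spanning forests of $\Gamma$. An organisational situation $(N,v,\Gamma)$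 consists of a superadditive game $v$ on $N$ and a circuit-free digraph $\Gamma$ on $N$. For $F\in\mathcal{F}^\Gamma$ and $i\in N$ set $$m_i^{(v,\Gamma)}(F)=v(\bar S^F(i))-\sum_{j\in\widehat S^F(i)}v(\bar S^F(j)).$$ The average forest measure is $$AF_i(N,v,\Gamma)=\frac{1}{|\mathcal{F}^\Gamma|}\sum_{F\in\mathcal{F}^\Gamma}m_i^{(v,\Gamma)}(F),\qquad i\in N.$$ *)

theory Defs
  imports Complex_Main "Graph_Theory.Digraph_Component"
begin

subsection \<open>Cooperative games\<close>

text \<open>A TU game on \<open>N\<close> is a function on all sets of players, of which only the values on
  subsets of \<open>N\<close> matter.\<close>

definition tu_game :: "('a set \<Rightarrow> real) \<Rightarrow> bool" where
  "tu_game v \<longleftrightarrow> v {} = 0"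

definition superadditive :: "'a set \<Rightarrow> ('a set \<Rightarrow> real) \<Rightarrow> bool" where
  "superadditive N v \<longleftrightarrow>
     (\<forall>S Q. S \<subseteq> N \<and> Q \<subseteq> N \<and> S \<inter> Q = {} \<longrightarrow> v (S \<union> Q) \<ge> v S + v Q)"


subsection \<open>Digraphs\<close>

definition successors :: "('a, 'b) pre_digraph \<Rightarrow> 'a \<Rightarrow> 'a set" where
  "successors G i = {j. i \<rightarrow>\<^sup>+\<^bsub>G\<^esub> j}"

definition imm_successors :: "('a, 'b) pre_digraph \<Rightarrow> 'a \<Rightarrow> 'a set" where
  "imm_successors G i = {j. i \<rightarrow>\<^bsub>G\<^esub> j}"

definition closed_successors :: "('a, 'b) pre_digraph \<Rightarrow> 'a \<Rightarrow> 'a set" where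
  "closed_successors G i = successors G i \<union> {i}"

text \<open>\<open>pre_digraph.cycle\<close> also counts loops as cycles; digraphs here have no loops, so
  this is the absence of directed cycles of length at least 2.\<close>

definition circuit_free :: "('a, 'b) pre_digraph \<Rightarrow> bool" where
  "circuit_free G \<longleftrightarrow> \<not> (\<exists>p. pre_digraph.cycle G p)"

text \<open>\<open>Digraph_Component.connected\<close> is connectedness of the symmetrised digraph, that is,
  weak connectedness. It includes non-emptiness. The following is the analogue of
  \<open>pre_digraph.sccs\<close> for it.\<close>

definition weak_components :: "('a, 'b) pre_digraph \<Rightarrow> ('a, 'b) pre_digraph set" where
  "weak_components G =
     {H. induced_subgraph H G \<and> Digraph_Component.connected H \<and>
         \<not> (\<exists>H'. induced_subgraph H' G \<and> Digraph_Component.connected H' \<and> verts H \<subset> verts H')}"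


subsection \<open>Arborescences and maximal spanning forests\<close>

definition is_root :: "('a, 'b) pre_digraph \<Rightarrow> 'a \<Rightarrow> bool" where
  "is_root T r \<longleftrightarrow> r \<in> verts T \<and> (\<forall>x\<in>verts T. x \<noteq> r \<longrightarrow> r \<rightarrow>\<^sup>*\<^bsub>T\<^esub> x)"

definition arborescence :: "('a, 'b) pre_digraph \<Rightarrow> bool" where
  "arborescence T \<longleftrightarrow>
     digraph T \<and> Digraph_Component.connected T \<and> circuit_free T \<and>
     (\<exists>!r. is_root T r) \<and>
     (\<forall>r. is_root T r \<longrightarrow> (\<forall>x\<in>verts T. x \<noteq> r \<longrightarrow> (\<exists>!p. pre_digraph.apath T r p x)))"

text \<open>Not to be confused with \<open>Digraph_Component.forest\<close>, which only asks for the absence of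
  cycles.\<close>

definition directed_forest :: "('a, 'b) pre_digraph \<Rightarrow> bool" where
  "directed_forest F \<longleftrightarrow> digraph F \<and> (\<forall>C\<in>weak_components F. arborescence C)"

definition spanning_forest :: "('a, 'b) pre_digraph \<Rightarrow> ('a, 'b) pre_digraph \<Rightarrow> bool" where
  "spanning_forest F G \<longleftrightarrow> spanning F G \<and> directed_forest F"

text \<open>\<open>spanning F G\<close> forces the tail and head functions of \<open>F\<close> to be those of \<open>G\<close>, so the
  elements of the following set correspond one-to-one to their arc sets, and its cardinality is
  the number of maximal spanning forests.\<close>

definition max_spanning_forests :: "('a, 'b) pre_digraph \<Rightarrow> ('a, 'b) pre_digraph set" where
  "max_spanning_forests G =
     {F. spanning_forest F G \<and>
         (\<forall>a\<in>arcs G - arcs F. \<not> directed_forest (pre_digraph.add_arc F a))}"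


subsection \<open>The average forest measure\<close>

definition organisational_situation ::
    "'a set \<Rightarrow> ('a set \<Rightarrow> real) \<Rightarrow> 'a pair_pre_digraph \<Rightarrow> bool" where
  "organisational_situation N v \<Gamma> \<longleftrightarrow>
     tu_game v \<and> superadditive N v \<and>
     pair_digraph \<Gamma> \<and> pverts \<Gamma> = N \<and> circuit_free (with_proj \<Gamma>)"

definition forest_marginal ::
    "('a set \<Rightarrow> real) \<Rightarrow> ('a, 'b) pre_digraph \<Rightarrow> 'a \<Rightarrow> real" where
  "forest_marginal v F i =
     v (closed_successors F i) - (\<Sum>j\<in>imm_successors F i. v (closed_successors F j))"

definition average_forest_measure ::
    "('a set \<Rightarrow> real) \<Rightarrow> ('a, 'b) pre_digraph \<Rightarrow> 'a \<Rightarrow> real" where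
  "average_forest_measure v G i =
     1 / real (card (max_spanning_forests G)) *
     (\<Sum>F\<in>max_spanning_forests G. forest_marginal v F i)"

end

theory Submission
  imports Defs
begin

text \<open>A spanning subgraph of a circuit-free digraph is a forest iff no two of its arcs have the same
  head, so a maximal spanning forest amounts to choosing independently, for every node with a
  predecessor, exactly one of the arcs entering it. For \<open>k\<close> a successor of \<open>j\<^sub>0\<close> or \<open>j\<^sub>0\<close> itself, no arc
  entering \<open>j\<^sub>0\<close> lies on a path starting at \<open>k\<close>, so the marginal of \<open>k\<close> does not depend on the arc
  chosen for \<open>j\<^sub>0\<close>. Averaging it over the forests of \<open>\<Gamma>\<close>, or over those of \<open>\<Gamma>\<close> without
  \<open>(i\<^sub>0, j\<^sub>0)\<close>, therefore gives the same as averaging over the choices at the nodes other than \<open>j\<^sub>0\<close>.\<close>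

subsection \<open>Circuit-free digraphs\<close>

lemma circuit_free_not_closed_w:
  assumes "wf_digraph G" "circuit_free G"
  shows "\<not> wf_digraph.closed_w G p"
  using assms wf_digraph.closed_w_imp_cycle unfolding circuit_free_def by blast

lemma circuit_free_awalk_self:
  assumes "wf_digraph G" "circuit_free G" "pre_digraph.awalk G u p u"
  shows "p = []"
  using circuit_free_not_closed_w[OF assms(1,2), of p] assms(3)
  by (auto simp: wf_digraph.closed_w_def[OF assms(1)])

lemma circuit_free_not_reachable1:
  assumes "wf_digraph G" "circuit_free G"
  shows "\<not> x \<rightarrow>\<^sup>+\<^bsub>G\<^esub> x"
  using circuit_free_awalk_self[OF assms] wf_digraph.reachable1_awalk[OF assms(1)] by blast

text \<open>A repeated vertex would cut a nonempty closed walk out of the walk.\<close>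

lemma circuit_free_apath:
  assumes "wf_digraph G" "circuit_free G" "pre_digraph.awalk G u p v"
  shows "pre_digraph.apath G u p v"
  using wf_digraph.awalk_not_distinct_decomp[OF assms(1,3)] circuit_free_awalk_self[OF assms(1,2)]
    assms(3) by (fastforce simp: pre_digraph.apath_def)

lemma circuit_free_subgraph:
  assumes "circuit_free G" "subgraph H G"
  shows "circuit_free H"
  using assms wf_digraph.subgraph_cycle[of G H] unfolding circuit_free_def by blast

text \<open>A finite acyclic arc relation is well-founded, and a minimal vertex has no entering
  arc.\<close>

lemma circuit_free_ex_source:
  assumes "fin_digraph G" "circuit_free G" "verts G \<noteq> {}"
  obtains r where "r \<in> verts G" "\<And>a. a \<in> arcs G \<Longrightarrow> head G a \<noteq> r"
proof -
  interpret fin_digraph G by fact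
  have "wf (arcs_ends G)"
  proof (rule finite_acyclic_wf)
    show "finite (arcs_ends G)" by (simp add: arcs_ends_conv)
    show "acyclic (arcs_ends G)"
      using circuit_free_not_reachable1[OF wf_digraph assms(2)] by (auto simp: acyclic_def)
  qed
  then obtain r where r: "r \<in> verts G" "\<And>y. (y, r) \<in> arcs_ends G \<Longrightarrow> y \<notin> verts G"
    using assms(3) by (metis all_not_in_conv wf_eq_minimal)
  show thesis
  proof (rule that[OF r(1)])
    show "head G a \<noteq> r" if "a \<in> arcs G" for a
      using r(2)[of "tail G a"] in_arcs_imp_in_arcs_ends[OF that] that by auto
  qed
qed

subsection \<open>Forests have in-degree at most one\<close>

text \<open>Reading walks backwards from \<open>x\<close>, the last arc is forced because only one
  arc enters each vertex. If just one of the walks ran out, the other would be a nonempty closed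
  walk at \<open>r\<close>.\<close>

lemma awalk_unique:
  assumes "wf_digraph G" "circuit_free G" "inj_on (head G) (arcs G)"
    and "pre_digraph.awalk G r p x" "pre_digraph.awalk G r q x"
  shows "p = q"
proof -
  interpret wf_digraph G by fact
  show ?thesis
    using assms(4,5)
  proof (induction p arbitrary: x q rule: rev_induct)
    case Nil
    then show ?case
      using circuit_free_awalk_self[OF assms(1,2)] by (auto simp: awalk_Nil_iff)
  next
    case (snoc a p)
    show ?case
    proof (cases q rule: rev_cases)
      case Nil
      then have "awalk r (p @ [a]) r"
        using snoc.prems by (auto simp: awalk_Nil_iff simp del: awalk_append_iff)
      then show ?thesis using circuit_free_awalk_self[OF assms(1,2)] by blast
    next
      case (snoc q' b)
      have a: "awalk r p (tail G a)" "a \<in> arcs G" "head G a = x"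
        using snoc.prems(1) by (auto simp: awalk_simps)
      have b: "awalk r q' (tail G b)" "b \<in> arcs G" "head G b = x"
        using snoc.prems(2) \<open>q = _\<close> by (auto simp: awalk_simps)
      have "a = b" using a b assms(3) by (auto dest: inj_onD)
      with snoc.IH[OF a(1)] b(1) \<open>q = _\<close> show ?thesis by simp
    qed
  qed
qed

text \<open>Used to show that a set which no arc enters or leaves exhausts a weakly connected
  digraph as soon as it contains one vertex.\<close>

lemma mk_symmetric_reachable_closed:
  assumes "x \<rightarrow>\<^sup>*\<^bsub>mk_symmetric G\<^esub> y" "x \<in> R"
    and "\<And>a. a \<in> arcs G \<Longrightarrow> tail G a \<in> R \<longleftrightarrow> head G a \<in> R"
  shows "y \<in> R"
  using assms(1)[unfolded reachable_def] assms(2)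
  by (induction rule: rtrancl_on_induct) (use assms(3) in \<open>auto simp: parcs_mk_symmetric\<close>)

text \<open>A source \<open>r\<close> is the root: no arc enters or leaves the set of vertices
  reachable from \<open>r\<close>, so weak connectedness makes it everything. Uniqueness of paths is
  \<open>awalk_unique\<close>.\<close>

lemma arborescenceI:
  assumes "digraph T" "Digraph_Component.connected T" "circuit_free T" "inj_on (head T) (arcs T)"
  shows "arborescence T"
proof -
  interpret digraph T by fact
  note wf = wf_digraph
  have "verts T \<noteq> {}"
    using assms(2) by (auto simp: connected_def strongly_connected_def)
  then obtain r where r: "r \<in> verts T" "\<And>a. a \<in> arcs T \<Longrightarrow> head T a \<noteq> r"
    using circuit_free_ex_source[OF fin_digraph assms(3)] by blast
  have reach: "r \<rightarrow>\<^sup>*\<^bsub>T\<^esub> x" if "x \<in> verts T" for x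
  proof -
    have "tail T a \<in> {y. r \<rightarrow>\<^sup>*\<^bsub>T\<^esub> y} \<longleftrightarrow> head T a \<in> {y. r \<rightarrow>\<^sup>*\<^bsub>T\<^esub> y}" if a: "a \<in> arcs T" for a
    proof
      assume "tail T a \<in> {y. r \<rightarrow>\<^sup>*\<^bsub>T\<^esub> y}"
      then show "head T a \<in> {y. r \<rightarrow>\<^sup>*\<^bsub>T\<^esub> y}"
        using in_arcs_imp_in_arcs_ends[OF a] reachable_adj_trans by blast
    next
      assume "head T a \<in> {y. r \<rightarrow>\<^sup>*\<^bsub>T\<^esub> y}"
      then obtain p where p: "awalk r p (head T a)" by (auto simp: reachable_awalk)
      show "tail T a \<in> {y. r \<rightarrow>\<^sup>*\<^bsub>T\<^esub> y}"
      proof (cases p rule: rev_cases)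
        case Nil
        with p r(2)[OF a] show ?thesis by (auto simp: awalk_Nil_iff)
      next
        case (snoc q b)
        then have q: "awalk r q (tail T b)" "b \<in> arcs T" "head T b = head T a"
          using p by (auto simp: awalk_simps)
        \<comment> \<open>The walk from \<open>r\<close> can only arrive through \<open>a\<close>,
          so it has already visited \<open>tail T a\<close>.\<close>
        then have "a = b" using assms(4) a by (auto dest: inj_onD)
        with q show ?thesis by (auto simp: reachable_awalk)
      qed
    qed
    moreover have "r \<rightarrow>\<^sup>*\<^bsub>mk_symmetric T\<^esub> x"
      using assms(2) r(1) that by (auto simp: connected_def strongly_connected_def)
    ultimately show ?thesis
      using mk_symmetric_reachable_closed[of T r x "{y. r \<rightarrow>\<^sup>*\<^bsub>T\<^esub> y}"] r(1) by auto
  qed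
  have "\<exists>!r. is_root T r"
  proof
    show "is_root T r" using r(1) reach by (auto simp: is_root_def)
    show "s = r" if "is_root T s" for s
    \<comment> \<open>Two distinct roots would reach each other and so lie on a circuit.\<close>
    proof (rule ccontr)
      assume "s \<noteq> r"
      with that r(1) have "s \<rightarrow>\<^sup>*\<^bsub>T\<^esub> r" "s \<in> verts T" by (auto simp: is_root_def)
      with reach \<open>s \<noteq> r\<close> have "s \<rightarrow>\<^sup>+\<^bsub>T\<^esub> s"
        using reachable_neq_reachable1 reachable1_reachable_trans by metis
      then show False using circuit_free_not_reachable1[OF wf assms(3)] by blast
    qed
  qed
  moreover have "\<exists>!p. apath s p x" if "is_root T s" "x \<in> verts T" "x \<noteq> s" for s x
  proof -
    have "s \<rightarrow>\<^sup>*\<^bsub>T\<^esub> x" using that by (auto simp: is_root_def)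
    then obtain p where "apath s p x" by (auto simp: reachable_apath)
    then show ?thesis
      using awalk_unique[OF wf assms(3,4)] awalkI_apath by blast
  qed
  ultimately show ?thesis
    using assms by (auto simp: arborescence_def)
qed

text \<open>Among the connected induced subgraphs whose vertices include those of \<open>H\<close>,
  one with the most vertices is a component.\<close>

lemma weak_component_containing:
  assumes "fin_digraph G" "induced_subgraph H G" "Digraph_Component.connected H"
  obtains C where "C \<in> weak_components G" "verts H \<subseteq> verts C"
proof -
  interpret fin_digraph G by fact
  let ?P = "\<lambda>K. induced_subgraph K G \<and> Digraph_Component.connected K \<and> verts H \<subseteq> verts K"
  have "card (verts K) \<le> card (verts G)" if "?P K" for K
    using that by (intro card_mono) (auto simp: induced_subgraph_def subgraph_def)
  then obtain C where C: "?P C" "\<And>K. ?P K \<Longrightarrow> card (verts K) \<le> card (verts C)"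
    using ex_has_greatest_nat[of ?P H "\<lambda>K. card (verts K)" "Suc (card (verts G))"] assms(2,3)
    by (metis less_Suc_eq_le order_refl)
  have "\<not> verts C \<subset> verts K" if "induced_subgraph K G" "Digraph_Component.connected K" for K
  proof
    assume "verts C \<subset> verts K"
    moreover have "finite (verts K)"
      using that(1) finite_verts by (auto simp: induced_subgraph_def subgraph_def dest: finite_subset)
    ultimately show False
      using psubset_card_mono[of "verts K" "verts C"] C(2)[of K] C(1) that by auto
  qed
  then show thesis
    using C(1) that[of C] by (auto simp: weak_components_def)
qed

text \<open>Every vertex of the symmetrised subgraph is joined to the common head. This places two
  arcs with the same head in one weak component.\<close>

lemma connected_arcs_into:
  assumes "wf_digraph G" "a \<in> arcs G" "b \<in> arcs G" "head G a = head G b"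
  shows "Digraph_Component.connected (G \<restriction> {tail G a, tail G b, head G a})"
proof -
  interpret wf_digraph G by fact
  let ?H = "G \<restriction> {tail G a, tail G b, head G a}"
  interpret H: wf_digraph ?H using assms by auto
  interpret S: pair_wf_digraph "mk_symmetric ?H" ..
  have into: "x \<rightarrow>\<^sup>*\<^bsub>mk_symmetric ?H\<^esub> head G a" "head G a \<rightarrow>\<^sup>*\<^bsub>mk_symmetric ?H\<^esub> x"
    if "x \<in> verts ?H" for x
  proof -
    have "(tail G a, head G a) \<in> arcs_ends ?H" "(tail G b, head G a) \<in> arcs_ends ?H"
      using assms by (auto simp: arcs_ends_conv)
    then have "x \<rightarrow>\<^sup>*\<^bsub>?H\<^esub> head G a" using that by auto
    then show *: "x \<rightarrow>\<^sup>*\<^bsub>mk_symmetric ?H\<^esub> head G a" by (rule H.reachable_mk_symmetricI)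
    show "head G a \<rightarrow>\<^sup>*\<^bsub>mk_symmetric ?H\<^esub> x"
      by (rule symmetric_reachable[OF symmetric_mk_symmetric *])
  qed
  have "verts ?H \<noteq> {}" by simp
  then show ?thesis
    unfolding connected_def using into S.reachable_trans
    unfolding strongly_connected_def with_proj_simps pverts_mk_symmetric by blast
qed

text \<open>Two arcs with a common head extend paths from the root to two paths ending there;
  uniqueness identifies these, hence also their last arcs.\<close>

lemma arborescence_inj_on_head:
  assumes "arborescence T"
  shows "inj_on (head T) (arcs T)"
proof (rule inj_onI)
  interpret digraph T using assms by (simp add: arborescence_def)
  have cf: "circuit_free T" using assms by (simp add: arborescence_def)
  obtain r where r: "is_root T r" using assms by (auto simp: arborescence_def)
  have walk: "\<exists>p. awalk r (p @ [a]) (head T a)" if "a \<in> arcs T" for a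
  proof -
    have "r \<rightarrow>\<^sup>*\<^bsub>T\<^esub> tail T a"
      using r that by (cases "tail T a = r") (auto simp: is_root_def)
    then obtain p where "awalk r p (tail T a)" by (auto simp: reachable_awalk)
    then show ?thesis using arc_implies_awalk[OF that] awalk_appendI by blast
  qed
  fix a b assume ab: "a \<in> arcs T" "b \<in> arcs T" "head T a = head T b"
  obtain p q where p: "awalk r (p @ [a]) (head T a)" and q: "awalk r (q @ [b]) (head T a)"
    using walk[OF ab(1)] walk[OF ab(2)] ab(3) by auto
  \<comment> \<open>The definition grants unique paths only to vertices other than the root.\<close>
  have "head T a \<noteq> r"
    using circuit_free_awalk_self[OF wf_digraph cf, of r "p @ [a]"] p by auto
  then have "\<exists>!p. apath r p (head T a)"
    using assms r ab(1) by (auto simp: arborescence_def)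
  then have "p @ [a] = q @ [b]"
    using circuit_free_apath[OF wf_digraph cf] p q by blast
  then show "a = b" by simp
qed

text \<open>Trades the condition on components for a local one on arcs: arcs with the same head
  share a component, and conversely injectivity of \<open>head\<close> passes to each
  component.\<close>

lemma directed_forest_iff:
  assumes "digraph F" "circuit_free F"
  shows "directed_forest F \<longleftrightarrow> inj_on (head F) (arcs F)"
proof
  interpret digraph F by fact
  assume F: "directed_forest F"
  show "inj_on (head F) (arcs F)"
  proof (rule inj_onI)
    fix a b assume ab: "a \<in> arcs F" "b \<in> arcs F" "head F a = head F b"
    let ?H = "F \<restriction> {tail F a, tail F b, head F a}"
    have "induced_subgraph ?H F" using ab by (intro induced_induce) auto
    then obtain C where C: "C \<in> weak_components F" "verts ?H \<subseteq> verts C"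
      using weak_component_containing[OF fin_digraph _ connected_arcs_into[OF wf_digraph ab]]
      by blast
    then have "inj_on (head C) (arcs C)"
      using F arborescence_inj_on_head by (auto simp: directed_forest_def)
    \<comment> \<open>\<open>C\<close> is induced and contains the endpoints of both arcs.\<close>
    moreover have "a \<in> arcs C" "b \<in> arcs C" "head C = head F"
      using C ab by (auto simp: weak_components_def induced_subgraph_def subgraph_def compatible_def)
    ultimately show "a = b" using ab(3) by (auto dest: inj_onD)
  qed
next
  interpret digraph F by fact
  assume inj: "inj_on (head F) (arcs F)"
  have "arborescence C" if "C \<in> weak_components F" for C
  proof (rule arborescenceI)
    have C: "subgraph C F" "Digraph_Component.connected C"
      using that by (auto simp: weak_components_def induced_subgraph_def)
    show "digraph C" using C(1) by (rule digraph_subgraph)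
    show "Digraph_Component.connected C" by fact
    show "circuit_free C" using circuit_free_subgraph[OF assms(2) C(1)] .
    show "inj_on (head C) (arcs C)"
      using inj C(1) by (auto simp: subgraph_def compatible_def intro: inj_on_subset)
  qed
  then show "directed_forest F" using assms(1) by (simp add: directed_forest_def)
qed

subsection \<open>Maximal spanning forests as transversals\<close>

text \<open>These sets pick exactly one element from each nonempty fibre of \<open>h\<close> on
  \<open>E\<close>; for \<open>h = head G\<close>, one arc into each node that has a
  predecessor.\<close>

definition transversals :: "('b \<Rightarrow> 'a) \<Rightarrow> 'b set \<Rightarrow> 'b set set" where
  "transversals h E = {A. A \<subseteq> E \<and> inj_on h A \<and> h ` A = h ` E}"

lemma directed_forest_spanning_iff:
  assumes "digraph G" "circuit_free G" "A \<subseteq> arcs G"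
  shows "spanning (G\<lparr>arcs := A\<rparr>) G"
    and "directed_forest (G\<lparr>arcs := A\<rparr>) \<longleftrightarrow> inj_on (head G) A"
proof -
  interpret digraph G by fact
  have "wf_digraph (G\<lparr>arcs := A\<rparr>)"
    by unfold_locales (use assms(3) in auto)
  then show "spanning (G\<lparr>arcs := A\<rparr>) G"
    using assms(3) wf_digraph by (auto simp: spanning_def subgraph_def compatible_def)
  then have "subgraph (G\<lparr>arcs := A\<rparr>) G" by (auto simp: spanning_def)
  then show "directed_forest (G\<lparr>arcs := A\<rparr>) \<longleftrightarrow> inj_on (head G) A"
    using directed_forest_iff[of "G\<lparr>arcs := A\<rparr>"] digraph_subgraph
      circuit_free_subgraph[OF assms(2)] by simp
qed

text \<open>For an arc set on which \<open>head G\<close> is injective, maximality says that every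
  further arc has a head already hit, so all heads of arcs of \<open>G\<close> are hit.\<close>

lemma max_spanning_forests_eq:
  assumes "digraph G" "circuit_free G"
  shows "max_spanning_forests G = (\<lambda>A. G\<lparr>arcs := A\<rparr>) ` transversals (head G) (arcs G)"
proof -
  interpret digraph G by fact
  note forest_iff = directed_forest_spanning_iff(2)[OF assms]
  have maximal: "G\<lparr>arcs := A\<rparr> \<in> max_spanning_forests G \<longleftrightarrow> A \<in> transversals (head G) (arcs G)"
    if A: "A \<subseteq> arcs G" for A
  proof -
    have "pre_digraph.add_arc (G\<lparr>arcs := A\<rparr>) a = G\<lparr>arcs := insert a A\<rparr>" if "a \<in> arcs G" for a
      using that by (auto simp: pre_digraph.add_arc_def intro!: pre_digraph.equality)
    then have "G\<lparr>arcs := A\<rparr> \<in> max_spanning_forests G \<longleftrightarrow>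
        inj_on (head G) A \<and> (\<forall>a\<in>arcs G - A. \<not> inj_on (head G) (insert a A))"
      using directed_forest_spanning_iff[OF assms A] forest_iff[of "insert _ A"] A
      by (auto simp: max_spanning_forests_def spanning_forest_def)
    also have "\<dots> \<longleftrightarrow> inj_on (head G) A \<and> (\<forall>a\<in>arcs G - A. head G a \<in> head G ` A)"
      by (auto simp: inj_on_insert)
    also have "\<dots> \<longleftrightarrow> A \<in> transversals (head G) (arcs G)"
      using A by (auto simp: transversals_def)
    finally show ?thesis .
  qed
  \<comment> \<open>A spanning subgraph shares vertices, tails and heads with \<open>G\<close>, so
    its arc set determines it.\<close>
  have "F = G\<lparr>arcs := arcs F\<rparr> \<and> arcs F \<subseteq> arcs G" if "F \<in> max_spanning_forests G" for F
    using that by (auto simp: max_spanning_forests_def spanning_forest_def spanning_def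
        subgraph_def compatible_def intro!: pre_digraph.equality)
  with maximal show ?thesis
    by (auto simp: image_iff transversals_def) metis+
qed

lemma average_forest_measure_transversals:
  assumes "digraph G" "circuit_free G"
  shows "average_forest_measure v G k =
    1 / real (card (transversals (head G) (arcs G))) *
      (\<Sum>A\<in>transversals (head G) (arcs G). forest_marginal v (G\<lparr>arcs := A\<rparr>) k)"
proof -
  have inj: "inj_on (\<lambda>A. G\<lparr>arcs := A\<rparr>) X" for X
    by (rule inj_onI) (drule arg_cong[where f = arcs], simp)
  show ?thesis
    unfolding average_forest_measure_def max_spanning_forests_eq[OF assms]
    by (simp add: card_image[OF inj] sum.reindex[OF inj])
qed

subsection \<open>Averages over transversals\<close>

text \<open>The choice in the fibre over \<open>j\<close> is independent of the choices in all other
  fibres.\<close>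

lemma transversals_fibre:
  assumes "{a\<in>E. h a = j} \<noteq> {}"
  shows "bij_betw (\<lambda>(a, B). insert a B) ({a\<in>E. h a = j} \<times> transversals h {a\<in>E. h a \<noteq> j})
    (transversals h E)"
  unfolding bij_betw_def
proof
  let ?I = "{a\<in>E. h a = j}" and ?E' = "{a\<in>E. h a \<noteq> j}"
  show "inj_on (\<lambda>(a, B). insert a B) (?I \<times> transversals h ?E')"
  proof (rule inj_onI, clarify)
    fix a B b C assume *: "a \<in> E" "b \<in> E" "h b = h a" "j = h a"
      "B \<in> transversals h {x\<in>E. h x \<noteq> h a}" "C \<in> transversals h {x\<in>E. h x \<noteq> h a}"
      and eq: "insert a B = insert b C"
    \<comment> \<open>Discarding what lies over \<open>j = h a\<close> recovers the second
      component.\<close>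
    have "B = {x \<in> insert a B. h x \<noteq> h a}" "C = {x \<in> insert b C. h x \<noteq> h a}"
      using * by (auto simp: transversals_def)
    with eq have "B = C" by simp
    moreover have "a \<notin> C" using * by (auto simp: transversals_def)
    ultimately show "a = b \<and> B = C" using eq by auto
  qed
  show "(\<lambda>(a, B). insert a B) ` (?I \<times> transversals h ?E') = transversals h E"
  proof (intro equalityI subsetI)
    fix A assume "A \<in> (\<lambda>(a, B). insert a B) ` (?I \<times> transversals h ?E')"
    then obtain a B where a: "a \<in> E" "h a = j" and B: "B \<in> transversals h ?E'" and A: "A = insert a B"
      by auto
    have "h ` E = insert j (h ` ?E')" using a by auto
    also have "\<dots> = h ` A" using a B A by (auto simp: transversals_def)
    finally have "h ` A = h ` E" by simp
    moreover have "inj_on h A" "A \<subseteq> E"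
      using a B A by (auto simp: transversals_def inj_on_insert)
    ultimately show "A \<in> transversals h E" by (simp add: transversals_def)
  next
    fix A assume "A \<in> transversals h E"
    then have A: "A \<subseteq> E" "inj_on h A" "h ` A = h ` E" by (simp_all add: transversals_def)
    obtain a where a: "a \<in> A" "h a = j"
    proof -
      have "j \<in> h ` A" using assms unfolding A(3) by auto
      then show thesis using that by auto
    qed
    let ?B = "{x\<in>A. h x \<noteq> j}"
    have "h ` ?B = h ` A - {j}" "h ` ?E' = h ` E - {j}" by auto
    then have "h ` ?B = h ` ?E'" unfolding A(3) by simp
    moreover have "inj_on h ?B" "?B \<subseteq> ?E'"
      using A(1,2) by (auto simp: inj_on_def)
    ultimately have "?B \<in> transversals h ?E'" by (simp add: transversals_def)
    moreover have "insert a ?B = A" using a A(2) by (auto simp: inj_on_def)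
    moreover have "a \<in> ?I" using A(1) a by blast
    ultimately show "A \<in> (\<lambda>(a, B). insert a B) ` (?I \<times> transversals h ?E')"
      by (intro image_eqI[where x = "(a, ?B)"]) simp_all
  qed
qed

text \<open>Each transversal of the other fibres is counted once per element of the fibre over
  \<open>j\<close>, always with the same value of \<open>f\<close>, so the size of that fibre
  cancels.\<close>

lemma average_transversals:
  fixes f :: "'b set \<Rightarrow> real"
  assumes "finite E" "\<And>A. A \<subseteq> E \<Longrightarrow> f A = f {a\<in>A. h a \<noteq> j}"
  shows "1 / real (card (transversals h E)) * sum f (transversals h E) =
    1 / real (card (transversals h {a\<in>E. h a \<noteq> j})) * sum f (transversals h {a\<in>E. h a \<noteq> j})"
proof (cases "{a\<in>E. h a = j} = {}")
  \<comment> \<open>This case occurs when the deleted arc was the only one into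
    \<open>j\<close>.\<close>
  case True
  then have "{a\<in>E. h a \<noteq> j} = E" by auto
  then show ?thesis by simp
next
  case False
  let ?I = "{a\<in>E. h a = j}" and ?T = "transversals h {a\<in>E. h a \<noteq> j}"
  note bij = transversals_fibre[OF False]
  have "sum f (transversals h E) = (\<Sum>(a, B)\<in>?I \<times> ?T. f (insert a B))"
    using sum.reindex_bij_betw[OF bij, of f] by (simp add: case_prod_beta)
  also have "\<dots> = (\<Sum>(a, B)\<in>?I \<times> ?T. f B)"
  proof (intro sum.cong refl)
    fix p assume "p \<in> ?I \<times> ?T"
    then obtain a B where p: "p = (a, B)" "a \<in> E" "h a = j" "B \<in> ?T" by auto
    then have "insert a B \<subseteq> E" "{x \<in> insert a B. h x \<noteq> j} = B"
      by (auto simp: transversals_def)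
    with assms(2)[of "insert a B"] p(1)
    show "(case p of (a, B) \<Rightarrow> f (insert a B)) = (case p of (a, B) \<Rightarrow> f B)" by simp
  qed
  also have "\<dots> = real (card ?I) * sum f ?T"
    by (simp add: sum.cartesian_product[symmetric])
  finally have "sum f (transversals h E) = real (card ?I) * sum f ?T" .
  moreover have "card (transversals h E) = card ?I * card ?T"
    using bij_betw_same_card[OF bij] by (simp add: card_cartesian_product)
  moreover have "card ?I \<noteq> 0" using False assms(1) by simp
  ultimately show ?thesis by simp
qed

subsection \<open>Locality of the marginals\<close>

lemma closed_successors_imm_successors:
  assumes "k \<in> closed_successors G j" "x \<in> imm_successors G k"
  shows "x \<in> closed_successors G j"
  using assms
  by (auto simp: closed_successors_def successors_def imm_successors_def intro: trancl_into_trancl)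

text \<open>Such an arc would close a circuit through \<open>j\<close>, or be a loop if
  \<open>k = j\<close>; \<open>circuit_free\<close> excludes both.\<close>

lemma arc_from_closed_successor:
  assumes "wf_digraph G" "circuit_free G" "k \<in> closed_successors G j" "a \<in> arcs G" "tail G a = k"
  shows "head G a \<noteq> j"
proof
  assume "head G a = j"
  then have "k \<rightarrow>\<^bsub>G\<^esub> j"
    using assms(4,5) wf_digraph.in_arcs_imp_in_arcs_ends[OF assms(1)] by auto
  with assms(3) have "j \<rightarrow>\<^sup>+\<^bsub>G\<^esub> j"
    by (auto simp: closed_successors_def successors_def)
  then show False using circuit_free_not_reachable1[OF assms(1,2)] by blast
qed

context
  fixes G :: "('a, 'b) pre_digraph" and A :: "'b set" and j :: 'a
  assumes wf: "wf_digraph G" and cf: "circuit_free G" and A: "A \<subseteq> arcs G"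
begin

lemma imm_successors_drop_arcs_into:
  assumes "k \<in> closed_successors G j"
  shows "imm_successors (G\<lparr>arcs := {a\<in>A. head G a \<noteq> j}\<rparr>) k = imm_successors (G\<lparr>arcs := A\<rparr>) k"
  using arc_from_closed_successor[OF wf cf assms] A
  by (fastforce simp: imm_successors_def arcs_ends_conv)

text \<open>A path from \<open>k\<close> visits only closed successors of \<open>j\<close> in
  \<open>G\<close>, so none of its arcs enters \<open>j\<close> and all survive the
  deletion.\<close>

lemma closed_successors_drop_arcs_into:
  assumes "k \<in> closed_successors G j"
  shows "closed_successors (G\<lparr>arcs := {a\<in>A. head G a \<noteq> j}\<rparr>) k = closed_successors (G\<lparr>arcs := A\<rparr>) k"
proof -
  let ?F = "G\<lparr>arcs := A\<rparr>" and ?F' = "G\<lparr>arcs := {a\<in>A. head G a \<noteq> j}\<rparr>"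
  have sub: "arcs_ends ?F' \<subseteq> arcs_ends ?F" "arcs_ends ?F \<subseteq> arcs_ends G"
    using A by (auto simp: arcs_ends_conv)
  have "k \<rightarrow>\<^sup>+\<^bsub>?F'\<^esub> x" if "k \<rightarrow>\<^sup>+\<^bsub>?F\<^esub> x" for x
    using that
  proof (induction rule: trancl_induct)
    case (base y)
    then show ?case
      using imm_successors_drop_arcs_into[OF assms] by (auto simp: imm_successors_def)
  next
    case (step y z)
    have "k \<rightarrow>\<^sup>+\<^bsub>G\<^esub> y" using step.hyps(1) sub(2) by (metis trancl_mono)
    with assms have "y \<in> closed_successors G j"
      by (auto simp: closed_successors_def successors_def intro: trancl_trans)
    then have "y \<rightarrow>\<^bsub>?F'\<^esub> z"
      using imm_successors_drop_arcs_into step.hyps(2) by (auto simp: imm_successors_def)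
    with step.IH show ?case by (rule trancl_into_trancl)
  qed
  moreover have "k \<rightarrow>\<^sup>+\<^bsub>?F\<^esub> x" if "k \<rightarrow>\<^sup>+\<^bsub>?F'\<^esub> x" for x
    using that sub(1) by (metis trancl_mono)
  ultimately show ?thesis by (auto simp: closed_successors_def successors_def)
qed

text \<open>The marginal involves only \<open>k\<close> and its immediate successors, and these are
  again closed successors of \<open>j\<close>.\<close>

lemma forest_marginal_drop_arcs_into:
  assumes "k \<in> closed_successors G j"
  shows "forest_marginal v (G\<lparr>arcs := {a\<in>A. head G a \<noteq> j}\<rparr>) k = forest_marginal v (G\<lparr>arcs := A\<rparr>) k"
proof -
  have "x \<in> closed_successors G j" if "x \<in> imm_successors (G\<lparr>arcs := A\<rparr>) k" for x
  proof (rule closed_successors_imm_successors[OF assms])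
    show "x \<in> imm_successors G k"
      using that A by (auto simp: imm_successors_def arcs_ends_conv)
  qed
  then show ?thesis
    unfolding forest_marginal_def imm_successors_drop_arcs_into[OF assms]
      closed_successors_drop_arcs_into[OF assms]
    by (simp add: closed_successors_drop_arcs_into)
qed

end

text \<open>The right-hand side does not mention \<open>E\<close>: any two digraphs obtained from
  \<open>G\<close> by deleting only arcs into \<open>j\<close> give \<open>k\<close> the same
  measure.\<close>

lemma average_forest_measure_drop_arcs_into:
  assumes "digraph G" "circuit_free G" "k \<in> closed_successors G j"
    and "E \<subseteq> arcs G" "{a\<in>arcs G. head G a \<noteq> j} \<subseteq> E"
  shows "average_forest_measure v (G\<lparr>arcs := E\<rparr>) k =
    1 / real (card (transversals (head G) {a\<in>arcs G. head G a \<noteq> j})) *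
      (\<Sum>A\<in>transversals (head G) {a\<in>arcs G. head G a \<noteq> j}. forest_marginal v (G\<lparr>arcs := A\<rparr>) k)"
proof -
  interpret digraph G by fact
  have sub: "subgraph (G\<lparr>arcs := E\<rparr>) G"
    using directed_forest_spanning_iff(1)[OF assms(1,2,4)] by (simp add: spanning_def)
  have "forest_marginal v (G\<lparr>arcs := A\<rparr>) k = forest_marginal v (G\<lparr>arcs := {a\<in>A. head G a \<noteq> j}\<rparr>) k"
    if "A \<subseteq> E" for A
    using forest_marginal_drop_arcs_into[OF wf_digraph assms(2) _ assms(3)] that assms(4) by auto
  then have "1 / real (card (transversals (head G) E)) *
      (\<Sum>A\<in>transversals (head G) E. forest_marginal v (G\<lparr>arcs := A\<rparr>) k) =
    1 / real (card (transversals (head G) {a\<in>E. head G a \<noteq> j})) *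
      (\<Sum>A\<in>transversals (head G) {a\<in>E. head G a \<noteq> j}. forest_marginal v (G\<lparr>arcs := A\<rparr>) k)"
    using assms(4) finite_subset[OF _ finite_arcs] by (intro average_transversals) auto
  moreover have "{a\<in>E. head G a \<noteq> j} = {a\<in>arcs G. head G a \<noteq> j}"
    using assms(4,5) by auto
  ultimately show ?thesis
    using average_forest_measure_transversals[OF digraph_subgraph[OF sub]
        circuit_free_subgraph[OF assms(2) sub]] by simp
qed

theorem corollary1:
  fixes n :: nat
    and v :: "nat set \<Rightarrow> real"
    and \<Gamma> :: "nat pair_pre_digraph"
    and i0 j0 :: nat
  assumes "n \<ge> 2"
    and "organisational_situation {1..n} v \<Gamma>"
    and "(i0, j0) \<in> parcs \<Gamma>"
  shows "\<forall>k\<in>closed_successors (with_proj \<Gamma>) j0.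
           average_forest_measure v (with_proj \<Gamma>) k =
           average_forest_measure v (pre_digraph.del_arc (with_proj \<Gamma>) (i0, j0)) k"
proof
  fix k assume k: "k \<in> closed_successors (with_proj \<Gamma>) j0"
  interpret pair_digraph \<Gamma>
    using assms(2) by (simp add: organisational_situation_def)
  let ?G = "with_proj \<Gamma>"
  have "digraph ?G" "circuit_free ?G"
    using assms(2) by (auto simp: organisational_situation_def) unfold_locales
  note average = average_forest_measure_drop_arcs_into[OF this k, of _ v]
  have "average_forest_measure v ?G k = average_forest_measure v (?G\<lparr>arcs := parcs \<Gamma>\<rparr>) k"
    by (simp add: with_proj_def)
  also have "\<dots> = average_forest_measure v (?G\<lparr>arcs := parcs \<Gamma> - {(i0, j0)}\<rparr>) k"
    \<comment> \<open>Both arc sets retain every arc that does not enter \<open>j0\<close>.\<close>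
    using average[of "parcs \<Gamma>"] average[of "parcs \<Gamma> - {(i0, j0)}"] by fastforce
  also have "?G\<lparr>arcs := parcs \<Gamma> - {(i0, j0)}\<rparr> = pre_digraph.del_arc ?G (i0, j0)"
    by (simp add: pre_digraph.del_arc_def with_proj_def)
  finally show "average_forest_measure v ?G k =
      average_forest_measure v (pre_digraph.del_arc ?G (i0, j0)) k" .
qed

end
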